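(* Let $n\ge 1$ be an integer and let $x\in\mathbb{Z}$ with $x\neq 0,\pm1$. Then $$n\arctan\left(\frac1x\right)+\arctan\left(\frac{u_n(x)-v_n(x)}{u_n(x)+v_n(x)}\right)=\frac{\pi}{4}+k(n,x)\,\pi,$$ where $k(n,x)$ is the integer $$k(n,x)=\operatorname{sign}\left(n\arctan\left(\frac1x\right)-\frac{\pi}{4}\right)\left(\lfloor T\rfloor+\chi_{\left(\frac12,1\right)}(\{T\})\right),\qquad T=\frac{\left|\frac{\pi}{4}-n\arctan\left(\frac1x\right)\right|}{\pi},$$ and $$(u_n(x))_{n=0}^\infty=\mathcal W(1,x,2x,1+x^2),\qquad (v_n(x))_{n=0}^\infty=\mathcal W(0,1,2x,1+x^2).$$
   Context: $\mathcal W(\alpha,\beta,p,q)$ denotes the linear recurrent sequence $(a_n)_{n=0}^{\infty}$ of order 2 with $a_0=\alpha$, $a_1=\beta$, and $a_n=p\,a_{n-1}-q\,a_{n-2}$ for all $n\ge 2$. $\lfloor T\rfloor$ and $\{T\}$ are the integer part and the fractional part of $T$, and $\chi_{\left(\frac12,1\right)}$ is the characteristic function of the open interval $\left(\frac12,1\right)$. $\arctan$ takes values in $\left(-\frac{\pi}{2},\frac{\pi}{2}\right)$. *)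

theory Defs
  imports Complex_Main "HOL-Library.Indicator_Function"
begin

fun lin_rec :: "'a::comm_ring_1 \<Rightarrow> 'a \<Rightarrow> 'a \<Rightarrow> 'a \<Rightarrow> nat \<Rightarrow> 'a" where
  "lin_rec \<alpha> \<beta> p q 0 = \<alpha>"
| "lin_rec \<alpha> \<beta> p q (Suc 0) = \<beta>"
| "lin_rec \<alpha> \<beta> p q (Suc (Suc n)) = p * lin_rec \<alpha> \<beta> p q (Suc n) - q * lin_rec \<alpha> \<beta> p q n"

definition u :: "nat \<Rightarrow> int \<Rightarrow> int" where
  "u n x = lin_rec 1 x (2 * x) (1 + x\<^sup>2) n"

definition v :: "nat \<Rightarrow> int \<Rightarrow> int" where
  "v n x = lin_rec 0 1 (2 * x) (1 + x\<^sup>2) n"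

definition k :: "nat \<Rightarrow> int \<Rightarrow> real" where
  "k n x =
    (let T = \<bar>pi / 4 - real n * arctan (1 / real_of_int x)\<bar> / pi
     in sgn (real n * arctan (1 / real_of_int x) - pi / 4) *
        (real_of_int \<lfloor>T\<rfloor> + indicator {1/2<..<1} (frac T)))"

end

theory Submission
  imports Defs
begin

text \<open>
  The recurrence says that \<open>u n x + \<i> v n x = (x + \<i>) ^ n\<close>, whose argument is
  \<open>\<theta> = n * arctan (1 / x)\<close> modulo \<open>pi\<close>, so \<open>(u - v) / (u + v) = tan (pi / 4 - \<theta>)\<close> and the
  correction \<open>k n x\<close> is the integer nearest to \<open>(\<theta> - pi / 4) / pi\<close>. The denominator does not
  vanish because \<open>u + v\<close> is congruent to \<open>(2 * x) ^ (n - 1) * (x + 1)\<close> modulo \<open>1 + x\<^sup>2\<close>: if it were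
  zero, the odd part of \<open>1 + x\<^sup>2\<close> would divide \<open>x + 1\<close>, hence \<open>2\<close>, forcing \<open>x \<in> {-1, 0, 1}\<close>.
\<close>

text \<open>Multiplication by \<open>x + \<i>\<close>, split into real and imaginary parts; the
  second-order recurrence has the characteristic roots \<open>x + \<i>\<close> and
  \<open>x - \<i>\<close>.\<close>

lemma u_Suc_v_Suc:
  "u (Suc n) x = x * u n x - v n x \<and> v (Suc n) x = u n x + x * v n x"
proof (induction n)
  case 0
  then show ?case by (simp add: u_def v_def)
next
  case (Suc n)
  have "u (Suc (Suc n)) x = 2 * x * u (Suc n) x - (1 + x\<^sup>2) * u n x"
    "v (Suc (Suc n)) x = 2 * x * v (Suc n) x - (1 + x\<^sup>2) * v n x"
    by (simp_all add: u_def v_def)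
  then show ?case
    using Suc by (auto simp only:) (simp_all add: algebra_simps power2_eq_square)
qed

text \<open>De Moivre's formula. The sign of \<open>\<rho>\<close> is left free because
  \<open>arctan (1 / x)\<close> is the argument of \<open>x + \<i>\<close> only modulo
  \<open>pi\<close>: for negative \<open>x\<close> the factor \<open>\<rho>\<close> is
  negative.\<close>

lemma u_v_polar:
  fixes \<rho> a :: real
  assumes "\<rho> * cos a = of_int x" and "\<rho> * sin a = 1"
  shows "of_int (u n x) = \<rho> ^ n * cos (real n * a) \<and> of_int (v n x) = \<rho> ^ n * sin (real n * a)"
proof (induction n)
  case 0
  then show ?case by (simp add: u_def v_def)
next
  case (Suc n)
  have angle: "real (Suc n) * a = real n * a + a"
    by (simp add: algebra_simps)
  have "of_int (u (Suc n) x) = (\<rho> * cos a) * of_int (u n x) - (\<rho> * sin a) * of_int (v n x)"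
    "of_int (v (Suc n) x) = (\<rho> * sin a) * of_int (u n x) + (\<rho> * cos a) * of_int (v n x)"
    unfolding assms by (simp_all add: u_Suc_v_Suc)
  then show ?case
    unfolding angle using Suc by (simp add: cos_add sin_add algebra_simps)
qed

text \<open>Modulo \<open>1 + x\<^sup>2\<close> the recurrence loses its last term, so from index 1
  on, where the sum is \<open>x + 1\<close>, each step multiplies by \<open>2 * x\<close>.\<close>

lemma dvd_u_plus_v:
  "1 + x\<^sup>2 dvd u (Suc n) x + v (Suc n) x - (2 * x) ^ n * (x + 1)"
proof (induction n)
  case 0
  then show ?case by (simp add: u_def v_def)
next
  case (Suc n)
  have "u (Suc (Suc n)) x + v (Suc (Suc n)) x - (2 * x) ^ Suc n * (x + 1)
      = 2 * x * (u (Suc n) x + v (Suc n) x - (2 * x) ^ n * (x + 1)) - (1 + x\<^sup>2) * (u n x + v n x)"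
    by (simp add: u_def v_def algebra_simps)
  then show ?case
    using Suc by (metis dvd_diff dvd_mult dvd_triv_left)
qed

text \<open>For odd \<open>x\<close> the value is 2 modulo 4, so the prime 2 occurs at most once.
  Oddness of \<open>d\<close> later makes it coprime to \<open>2 * x\<close>.\<close>

lemma odd_part_one_plus_square:
  fixes x :: int
  obtains d where "odd d" and "1 + x\<^sup>2 = d \<or> 1 + x\<^sup>2 = 2 * d"
proof (cases "even x")
  case True
  then show ?thesis using that[of "1 + x\<^sup>2"] by simp
next
  case False
  then obtain y where "x = 2 * y + 1" by (elim oddE)
  then have "1 + x\<^sup>2 = 2 * (2 * (y * y + y) + 1)"
    by (simp add: power2_eq_square algebra_simps)
  then show ?thesis using that[of "2 * (y * y + y) + 1"] by simp
qed

lemma u_plus_v_nonzero: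
  assumes "x \<noteq> 0" and "x \<noteq> 1" and "x \<noteq> -1"
  shows "u n x + v n x \<noteq> 0"
proof
  assume zero: "u n x + v n x = 0"
  then obtain m where m: "n = Suc m"
    by (cases n) (auto simp: u_def v_def)
  obtain d where d: "odd d" "1 + x\<^sup>2 = d \<or> 1 + x\<^sup>2 = 2 * d"
    by (rule odd_part_one_plus_square)
  have d_dvd: "d dvd 1 + x\<^sup>2"
    using d(2) by auto
  have "d dvd (2 * x) ^ m * (x + 1)"
    using dvd_trans[OF d_dvd dvd_u_plus_v[of x m]] zero m by simp
  moreover have "coprime d ((2 * x) ^ m)"
  proof -
    have "coprime (1 + x\<^sup>2) x"
      by (rule coprimeI) (metis dvd_add_left_iff dvd_mult power2_eq_square)
    then have "coprime d x"
      using d_dvd by (meson coprime_divisors dvd_refl)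
    with \<open>odd d\<close> show ?thesis by simp
  qed
  ultimately have "d dvd x + 1"
    by (simp add: coprime_dvd_mult_right_iff)
  \<comment> \<open>This difference equals 2.\<close>
  then have "d dvd 1 + x\<^sup>2 - (x + 1) * (x - 1)"
    using d_dvd by (intro dvd_diff dvd_mult2)
  then have "d dvd 2"
    by (simp add: algebra_simps power2_eq_square)
  then have "\<bar>d\<bar> \<le> 2"
    using dvd_imp_le_int[of 2 d] by simp
  \<comment> \<open>An odd \<open>d\<close> with \<open>\<bar>d\<bar> \<le> 2\<close> is 1 or
    -1.\<close>
  then have "1 + x\<^sup>2 \<le> 2"
    using d by (auto simp: abs_le_iff) presburger+
  moreover have "\<bar>x\<bar> \<ge> 2"
    using assms by linarith
  then have "x\<^sup>2 \<ge> 2\<^sup>2"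
    by (metis abs_ge_zero abs_numeral power2_abs power_mono zero_le_numeral)
  ultimately show False by simp
qed

text \<open>\<open>K\<close> rounds \<open>\<phi> / pi\<close> to the nearest integer, so
  \<open>\<phi> - K * pi\<close> lies in the open interval on which \<open>arctan\<close> inverts
  \<open>tan\<close>.\<close>

lemma arctan_tan_nearest:
  fixes \<phi> :: real
  assumes "cos \<phi> \<noteq> 0"
  defines "T \<equiv> \<bar>\<phi>\<bar> / pi"
  defines "K \<equiv> sgn \<phi> * (of_int \<lfloor>T\<rfloor> + indicator {1/2<..<1} (frac T))"
  shows "K \<in> \<int>" and "\<phi> + arctan (tan (- \<phi>)) = K * pi"
proof -
  define r :: int where "r = \<lfloor>T\<rfloor> + (if 1/2 < frac T then 1 else 0)"
  have r: "of_int \<lfloor>T\<rfloor> + indicator {1/2<..<1} (frac T) = real_of_int r"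
    by (simp add: r_def indicator_def frac_lt_1)
  obtain s :: int where s: "sgn \<phi> = real_of_int s"
    by (metis sgn_if of_int_0 of_int_1 of_int_minus)
  have K: "K = of_int (s * r)"
    by (simp add: K_def r s)
  then show "K \<in> \<int>" by simp
  have abs_\<phi>: "\<bar>\<phi>\<bar> = T * pi"
    by (simp add: T_def)
  \<comment> \<open>A tie would make \<open>\<bar>\<phi>\<bar>\<close> an odd multiple of
    \<open>pi / 2\<close>, a zero of the cosine.\<close>
  have "frac T \<noteq> 1/2"
  proof
    assume "frac T = 1/2"
    then have "T = of_int \<lfloor>T\<rfloor> + 1/2"
      unfolding frac_def by simp
    then have "\<bar>\<phi>\<bar> = of_int \<lfloor>T\<rfloor> * pi + pi / 2"
      unfolding abs_\<phi> by (metis distrib_right mult_1 times_divide_eq_left)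
    then have "cos \<bar>\<phi>\<bar> = 0"
      using cos_zero_iff_int2 by blast
    with assms(1) show False by simp
  qed
  moreover have "T - of_int r = frac T - (if 1/2 < frac T then 1 else 0)"
    by (simp add: r_def frac_def)
  ultimately have "\<bar>T - of_int r\<bar> < 1/2"
    using frac_lt_1[of T] frac_ge_0[of T] by (smt (verit) field_sum_of_halves)
  then have "\<bar>(T - of_int r) * pi\<bar> < 1/2 * pi"
    unfolding abs_mult by (simp add: mult_strict_right_mono)
  then have near: "\<bar>\<bar>\<phi>\<bar> - of_int r * pi\<bar> < pi / 2"
    unfolding abs_\<phi> by (simp add: algebra_simps)
  have "\<bar>\<phi> - K * pi\<bar> < pi / 2"
  proof (cases "\<phi> = 0")
    case False
    then have "\<phi> - K * pi = sgn \<phi> * (\<bar>\<phi>\<bar> - of_int r * pi)"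
      by (simp add: K_def r algebra_simps abs_mult_sgn)
    then show ?thesis
      using near False by (simp add: abs_mult)
  qed (simp add: K_def)
  moreover have "tan (- \<phi> + K * pi) = tan (- \<phi>)"
    unfolding K by (rule tan_periodic_int)
  ultimately have "arctan (tan (- \<phi>)) = - \<phi> + K * pi"
    by (intro arctan_unique) linarith+
  then show "\<phi> + arctan (tan (- \<phi>)) = K * pi" by simp
qed

theorem mainTheorem3:
  fixes n :: nat and x :: int
  assumes "n \<ge> 1" and "x \<noteq> 0" and "x \<noteq> 1" and "x \<noteq> -1"
  shows "u n x + v n x \<noteq> 0 \<and> k n x \<in> \<int> \<and>
    real n * arctan (1 / real_of_int x)
      + arctan (real_of_int (u n x - v n x) / real_of_int (u n x + v n x))
    = pi / 4 + k n x * pi"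
proof -
  define a where "a = arctan (1 / real_of_int x)"
  define \<rho> where "\<rho> = real_of_int x / cos a"
  define \<phi> where "\<phi> = real n * a - pi / 4"
  have cos_a: "cos a \<noteq> 0"
    by (simp add: a_def)
  have "sin a / cos a = 1 / real_of_int x"
    using tan_arctan[of "1 / real_of_int x"] by (simp add: a_def tan_def)
  then have "\<rho> * cos a = of_int x" "\<rho> * sin a = 1"
    using cos_a \<open>x \<noteq> 0\<close> by (simp_all add: \<rho>_def field_simps)
  note uv = u_v_polar[OF this, of n]
  \<comment> \<open>The factor \<open>sqrt 2\<close> comes from
    \<open>cos t + sin t = sqrt 2 * cos (t - pi / 4)\<close>.\<close>
  define c where "c = \<rho> ^ n * sqrt 2"
  have two: "sqrt 2 * (sqrt 2 * y) = 2 * y" for y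
    by (simp flip: mult.assoc)
  have sum: "real_of_int (u n x + v n x) = c * cos \<phi>"
    and diff: "real_of_int (u n x - v n x) = c * sin (- \<phi>)"
    using uv by (simp_all add: c_def \<phi>_def cos_diff sin_diff cos_45 sin_45 two algebra_simps)
  have nz: "u n x + v n x \<noteq> 0"
    by (rule u_plus_v_nonzero) fact+
  \<comment> \<open>The arithmetic of \<open>u n x + v n x\<close> thus rules out the tie in the
    rounding.\<close>
  then have "c \<noteq> 0" "cos \<phi> \<noteq> 0"
    using sum by (metis mult_zero_left mult_zero_right of_int_eq_0_iff)+
  then have quot: "real_of_int (u n x - v n x) / real_of_int (u n x + v n x) = tan (- \<phi>)"
    unfolding sum diff by (simp add: tan_def)
  have k: "k n x = sgn \<phi> * (of_int \<lfloor>\<bar>\<phi>\<bar> / pi\<rfloor> + indicator {1/2<..<1} (frac (\<bar>\<phi>\<bar> / pi)))"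
    by (simp add: k_def \<phi>_def a_def Let_def abs_minus_commute)
  note near = arctan_tan_nearest[OF \<open>cos \<phi> \<noteq> 0\<close>, folded k]
  show ?thesis
    using nz near unfolding quot a_def[symmetric] by (simp add: \<phi>_def)
qed

end
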